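(* Let the RIS phase shifts be set as $\theta_n=-\angle h_{p,n}^\ast+\angle\sum_{k\in\mathcal{K}}w_k h_{r,k,n}^\ast$ for all $n=1,\dots,N$, with weight factors $w_k>0$, and suppose that the denoising factor scales linearly with $N$, i.e. $\lambda=cN$ for a constant $c>0$. With $K$, $M$, $c$ and all $w_k,\beta_i,p_i$ fixed independently of $N$, for every $k\in\mathcal{K}$ and $m\in\mathcal{M}$ the variances satisfy $$\mathbb{V}[\ell_k]=\mathcal{O}\left(\frac1N\right),\qquad \mathbb{V}[\ell_m]=\mathcal{O}\left(\frac1N\right)\qquad (N\to\infty).$$
   Context: Let $K,N,M\ge 1$ be integers, $\mathcal{K}=\{1,\dots,K\}$ (target devices) and $\mathcal{M}=\{K+1,\dots,K+M\}$ (interferers). The random vectors $\mathbf{h}_p=(h_{p,1},\dots,h_{p,N})^T$ and $\mathbf{h}_{r,i}=(h_{r,i,1},\dots,h_{r,i,N})^T$, $i\in\mathcal{K}\cup\mathcal{M}$, are mutually independent, each distributed as $\mathcal{CN}(\mathbf{0},\mathbf{I}_N)$ (i.i.d. circularly symmetric complex Gaussian entries of mean $0$ and variance $\mathbb{E}|\cdot|^2=1$). The constants $\beta_i>0$ (large-scale fading coefficients), $p_i>0$ (transmit powers), and $\lambda>0$ (denoising factor) are deterministic. The reflecting matrix is $\mathbf{\Theta}=\mathrm{diag}\{e^{j\theta_1},\dots,e^{j\theta_N}\}$ with $j=\sqrt{-1}$ (phases are understood modulo $2\pi$). $\angle z$ is the argument of $z$, $z^\ast$ the complex conjugate, $(\cdot)^H$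 the conjugate transpose, $\Re$ the real part. For $i\in\mathcal{K}\cup\mathcal{M}$ define $$\ell_i=\frac{\beta_i\sqrt{p_i}}{\lambda}\,\Re\{\mathbf{h}_p^H\mathbf{\Theta}\mathbf{h}_{r,i}\}.$$ $\mathbb{V}$ denotes variance. *)

theory Defs
  imports "HOL-Probability.Probability" "HOL-Library.Landau_Symbols"
begin

text \<open>
  Vectors of length \<open>N\<close> are functions on \<open>nat\<close> of which only the values at \<open>1, \<dots>, N\<close> matter;
  as elements of a product space they are restricted to \<open>{1..N}\<close>. This allows the dimension
  \<open>N\<close> to tend to infinity inside a statement.
\<close>

abbreviation cvec_space :: "nat \<Rightarrow> (nat \<Rightarrow> complex) measure" where
  "cvec_space N \<equiv> (\<Pi>\<^sub>M n\<in>{1..N}. borel)"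

abbreviation random_cvec :: "nat \<Rightarrow> ('a \<Rightarrow> nat \<Rightarrow> complex) \<Rightarrow> 'a \<Rightarrow> nat \<Rightarrow> complex" where
  "random_cvec N h \<equiv> (\<lambda>\<omega>. restrict (h \<omega>) {1..N})"

text \<open>
  The distribution \<open>CN(0,1)\<close>: real and imaginary part are independent real Gaussians with mean
  \<open>0\<close> and variance \<open>1/2\<close>. The second parameter of \<^const>\<open>normal_density\<close> is the standard
  deviation.
\<close>

definition complex_std_normal :: "complex measure" where
  "complex_std_normal =
     distr (density lborel (normal_density 0 (sqrt (1/2))) \<Otimes>\<^sub>M
            density lborel (normal_density 0 (sqrt (1/2))))
       borel (\<lambda>(x, y). Complex x y)"

definition complex_std_normal_vec :: "nat \<Rightarrow> (nat \<Rightarrow> complex) measure" where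
  "complex_std_normal_vec N = (\<Pi>\<^sub>M n\<in>{1..N}. complex_std_normal)"

definition CN_distributed :: "'a measure \<Rightarrow> nat \<Rightarrow> ('a \<Rightarrow> nat \<Rightarrow> complex) \<Rightarrow> bool" where
  "CN_distributed P N h \<longleftrightarrow>
     random_cvec N h \<in> measurable P (cvec_space N) \<and>
     distr P (cvec_space N) (random_cvec N h) = complex_std_normal_vec N"

text \<open>
  In the mutually independent family below, the index \<^const>\<open>None\<close> stands for \<open>h\<^sub>p\<close> and
  \<open>Some i\<close> for \<open>h\<^sub>r\<^sub>,\<^sub>i\<close>.
\<close>

definition channel_model ::
  "'a measure \<Rightarrow> nat \<Rightarrow> nat set \<Rightarrow> ('a \<Rightarrow> nat \<Rightarrow> complex) \<Rightarrow> (nat \<Rightarrow> 'a \<Rightarrow> nat \<Rightarrow> complex) \<Rightarrow> bool"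
where
  "channel_model P N I hp hr \<longleftrightarrow>
     prob_space P \<and>
     CN_distributed P N hp \<and>
     (\<forall>i\<in>I. CN_distributed P N (hr i)) \<and>
     prob_space.indep_vars P (\<lambda>_. cvec_space N)
       (\<lambda>j. random_cvec N (case j of None \<Rightarrow> hp | Some i \<Rightarrow> hr i))
       (insert None (Some ` I))"

definition reflecting_matrix :: "(nat \<Rightarrow> real) \<Rightarrow> nat \<Rightarrow> nat \<Rightarrow> complex" where
  "reflecting_matrix \<theta> m n = (if m = n then cis (\<theta> n) else 0)"

text \<open>The sesquilinear form \<open>u\<^sup>H A v\<close>.\<close>

definition sesq_form ::
  "nat \<Rightarrow> (nat \<Rightarrow> complex) \<Rightarrow> (nat \<Rightarrow> nat \<Rightarrow> complex) \<Rightarrow> (nat \<Rightarrow> complex) \<Rightarrow> complex" where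
  "sesq_form N u A v = (\<Sum>m=1..N. \<Sum>n=1..N. cnj (u m) * A m n * v n)"

definition ell ::
  "nat \<Rightarrow> real \<Rightarrow> (nat \<Rightarrow> real) \<Rightarrow> (nat \<Rightarrow> real) \<Rightarrow> (nat \<Rightarrow> real) \<Rightarrow>
   (nat \<Rightarrow> complex) \<Rightarrow> (nat \<Rightarrow> nat \<Rightarrow> complex) \<Rightarrow> nat \<Rightarrow> real" where
  "ell N lam \<beta> p \<theta> hp hr i =
     \<beta> i * sqrt (p i) / lam * Re (sesq_form N hp (reflecting_matrix \<theta>) (hr i))"

text \<open>
  \<^const>\<open>Arg\<close> takes values in \<open>(-\<pi>, \<pi>]\<close> with \<open>Arg 0 = 0\<close>; the latter convention only matters on a
  null set.
\<close>

definition weighted_phase ::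
  "nat \<Rightarrow> (nat \<Rightarrow> real) \<Rightarrow> (nat \<Rightarrow> complex) \<Rightarrow> (nat \<Rightarrow> nat \<Rightarrow> complex) \<Rightarrow> nat \<Rightarrow> real" where
  "weighted_phase K w hp hr n =
     - Arg (cnj (hp n)) + Arg (\<Sum>k=1..K. of_real (w k) * cnj (hr k n))"

text \<open>
  \<open>\<ell>\<^sub>i\<close> as a random variable, with the phase shifts set to \<^const>\<open>weighted_phase\<close> and the denoising
  factor to \<open>c * N\<close>.
\<close>

definition ell_rv ::
  "nat \<Rightarrow> nat \<Rightarrow> real \<Rightarrow> (nat \<Rightarrow> real) \<Rightarrow> (nat \<Rightarrow> real) \<Rightarrow> (nat \<Rightarrow> real) \<Rightarrow>
   ('a \<Rightarrow> nat \<Rightarrow> complex) \<Rightarrow> (nat \<Rightarrow> 'a \<Rightarrow> nat \<Rightarrow> complex) \<Rightarrow> nat \<Rightarrow> 'a \<Rightarrow> real" where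
  "ell_rv K N c w \<beta> p hp hr i \<omega> =
     ell N (c * real N) \<beta> p (weighted_phase K w (hp \<omega>) (\<lambda>k. hr k \<omega>)) (hp \<omega>) (\<lambda>k. hr k \<omega>) i"

text \<open>
  The Bochner integral is \<open>0\<close> for non-integrable functions, so a statement about the variance of
  a random variable is accompanied by this condition.
\<close>

definition finite_variance :: "'a measure \<Rightarrow> ('a \<Rightarrow> real) \<Rightarrow> bool" where
  "finite_variance P X \<longleftrightarrow> integrable P X \<and> integrable P (\<lambda>\<omega>. (X \<omega>)\<^sup>2)"

end

theory Submission
  imports Defs
begin

text \<open>
  Since \<open>\<Theta>\<close> is diagonal, \<open>\<ell>\<^sub>i\<close> is \<open>\<beta>\<^sub>i \<surd>p\<^sub>i / (c N)\<close> times a sum of \<open>N\<close> terms, the \<open>n\<close>-th of which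
  depends only on the \<open>n\<close>-th entries of the channel vectors. The terms are therefore independent,
  and because the phase factor has modulus \<open>1\<close>, each has second moment at most
  \<open>E |h\<^sub>p\<^sub>,\<^sub>n|\<^sup>2 E |h\<^sub>r\<^sub>,\<^sub>i\<^sub>,\<^sub>n|\<^sup>2\<close>, which does not depend on \<open>N\<close>. The variances of the terms add up to
  \<open>O(N)\<close>, and the prefactor contributes \<open>O(1/N\<^sup>2)\<close>.
\<close>

section \<open>Independence of doubly indexed families and variance of sums\<close>

text \<open>The probability of a joint event factors twice: over the vectors by
  \<open>outer\<close>, then over the entries of each vector by \<open>inner\<close>. This turns the
  vector-level independence of the channel model into independence of all scalar entries, which can
  then be regrouped by position.\<close>

lemma (in prob_space) indep_vars_Times:
  assumes fin: "finite I" "I \<noteq> {}" "finite L" "L \<noteq> {}"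
    and outer: "indep_vars (\<lambda>i. PiM L (M' i)) (\<lambda>i \<omega>. restrict (X i \<omega>) L) I"
    and inner: "\<And>i. i \<in> I \<Longrightarrow> indep_vars (M' i) (\<lambda>n \<omega>. X i \<omega> n) L"
  shows "indep_vars (\<lambda>(i, n). M' i n) (\<lambda>(i, n) \<omega>. X i \<omega> n) (I \<times> L)"
proof -
  have rv: "random_variable (M' i n) (\<lambda>\<omega>. X i \<omega> n)" if "i \<in> I" "n \<in> L" for i n
    using inner[OF that(1)] that(2) by (auto simp: indep_vars_def)
  let ?F = "\<lambda>s. {(\<lambda>\<omega>. X (fst s) \<omega> (snd s)) -` A \<inter> space M | A. A \<in> sets (M' (fst s) (snd s))}"
  \<comment> \<open>The index set is finite and every family contains the whole space, so the
    product formula has to be checked only over all indices at once, not over each subset.\<close>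
  have "indep_sets ?F (I \<times> L)"
  proof (subst indep_sets_finite)
    show "I \<times> L \<noteq> {}" "finite (I \<times> L)" using fin by auto
    show "?F s \<subseteq> events" if "s \<in> I \<times> L" for s
      using that rv by (auto intro!: measurable_sets)
    show "space M \<in> ?F s" if "s \<in> I \<times> L" for s
      using that measurable_space[OF rv[of "fst s" "snd s"]]
      by (auto intro!: exI[of _ "space (M' (fst s) (snd s))"])
    show "\<forall>A\<in>Pi (I \<times> L) ?F. prob (\<Inter>s\<in>I \<times> L. A s) = (\<Prod>s\<in>I \<times> L. prob (A s))"
    proof
      fix A assume A: "A \<in> Pi (I \<times> L) ?F"
      have "\<forall>s\<in>I \<times> L. \<exists>B. B \<in> sets (M' (fst s) (snd s)) \<and>
              A s = (\<lambda>\<omega>. X (fst s) \<omega> (snd s)) -` B \<inter> space M"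
        using A unfolding Pi_iff by blast
      then obtain B where B: "\<And>s. s \<in> I \<times> L \<Longrightarrow> B s \<in> sets (M' (fst s) (snd s))"
        and AB: "\<And>s. s \<in> I \<times> L \<Longrightarrow> A s = (\<lambda>\<omega>. X (fst s) \<omega> (snd s)) -` B s \<inter> space M"
        by metis
      let ?C = "\<lambda>i. PiE L (\<lambda>n. B (i, n))"
      \<comment> \<open>Conditions on the single entries of vector \<open>i\<close> amount to one
        condition on the vector, membership in the box \<open>?C i\<close>, and this is an event to
        which \<open>outer\<close> applies.\<close>
      have C: "(\<lambda>\<omega>. restrict (X i \<omega>) L) -` ?C i \<inter> space M =
          (\<Inter>n\<in>L. (\<lambda>\<omega>. X i \<omega> n) -` B (i, n) \<inter> space M)" for i
        using fin by (auto simp: PiE_iff)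
      have "(\<Inter>s\<in>I \<times> L. A s) = (\<Inter>i\<in>I. \<Inter>n\<in>L. A (i, n))" by auto
      also have "\<dots> = (\<Inter>i\<in>I. (\<lambda>\<omega>. restrict (X i \<omega>) L) -` ?C i \<inter> space M)"
        unfolding C using AB by (intro INF_cong refl) auto
      also have "prob \<dots> = (\<Prod>i\<in>I. prob ((\<lambda>\<omega>. restrict (X i \<omega>) L) -` ?C i \<inter> space M))"
        using B fin by (intro indep_varsD_finite[OF outer] sets_PiM_I_finite) auto
      also have "\<dots> = (\<Prod>i\<in>I. \<Prod>n\<in>L. prob ((\<lambda>\<omega>. X i \<omega> n) -` B (i, n) \<inter> space M))"
        unfolding C using B fin by (intro prod.cong refl indep_varsD_finite[OF inner]) auto
      also have "\<dots> = (\<Prod>s\<in>I \<times> L. prob (A s))"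
        unfolding prod.cartesian_product by (intro prod.cong) (auto simp: AB)
      finally show "prob (\<Inter>s\<in>I \<times> L. A s) = (\<Prod>s\<in>I \<times> L. prob (A s))" .
    qed
  qed
  then show ?thesis
    unfolding indep_vars_def2 using rv by (auto simp: case_prod_unfold)
qed

text \<open>The majorant is f^2 + g^2, from 2 |f g| \<le> f^2 + g^2. It provides the integrability
  of the cross terms when the square of a sum is expanded.\<close>

lemma integrable_mult_of_squares:
  fixes f g :: "'a \<Rightarrow> real"
  assumes [measurable]: "f \<in> borel_measurable M" "g \<in> borel_measurable M"
    and "integrable M (\<lambda>x. (f x)\<^sup>2)" "integrable M (\<lambda>x. (g x)\<^sup>2)"
  shows "integrable M (\<lambda>x. f x * g x)"
proof (rule Bochner_Integration.integrable_bound)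
  show "integrable M (\<lambda>x. (f x)\<^sup>2 + (g x)\<^sup>2)" using assms by simp
  show "AE x in M. norm (f x * g x) \<le> norm ((f x)\<^sup>2 + (g x)\<^sup>2)"
  proof (rule AE_I2)
    fix x
    have "0 \<le> (\<bar>f x\<bar> - \<bar>g x\<bar>)\<^sup>2" by simp
    then have "2 * (\<bar>f x\<bar> * \<bar>g x\<bar>) \<le> (f x)\<^sup>2 + (g x)\<^sup>2" by (simp add: power2_diff)
    moreover have "0 \<le> \<bar>f x\<bar> * \<bar>g x\<bar>" by simp
    ultimately have "\<bar>f x\<bar> * \<bar>g x\<bar> \<le> (f x)\<^sup>2 + (g x)\<^sup>2" by linarith
    then show "norm (f x * g x) \<le> norm ((f x)\<^sup>2 + (g x)\<^sup>2)" by (simp add: abs_mult)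
  qed
qed measurable

lemma integrable_sum_square:
  fixes X :: "'i \<Rightarrow> 'a \<Rightarrow> real"
  assumes "\<And>i. i \<in> I \<Longrightarrow> X i \<in> borel_measurable M"
    and "\<And>i. i \<in> I \<Longrightarrow> integrable M (\<lambda>\<omega>. (X i \<omega>)\<^sup>2)"
  shows "integrable M (\<lambda>\<omega>. (\<Sum>i\<in>I. X i \<omega>)\<^sup>2)"
  unfolding power2_eq_square sum_product
  using assms by (intro Bochner_Integration.integrable_sum integrable_mult_of_squares)

text \<open>Bienayme's identity: after centring, the square of the sum expands into a double sum
  whose off-diagonal terms have expectation zero by independence.\<close>

lemma (in prob_space) variance_sum_indep:
  fixes X :: "'i \<Rightarrow> 'a \<Rightarrow> real"
  assumes fin: "finite I" and ind: "indep_vars (\<lambda>_. borel) X I"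
    and sq: "\<And>i. i \<in> I \<Longrightarrow> integrable M (\<lambda>\<omega>. (X i \<omega>)\<^sup>2)"
  shows "variance (\<lambda>\<omega>. \<Sum>i\<in>I. X i \<omega>) = (\<Sum>i\<in>I. variance (X i))"
proof -
  define Y where "Y i \<omega> = X i \<omega> - expectation (X i)" for i \<omega>
  have mX: "X i \<in> borel_measurable M" if "i \<in> I" for i
    using ind that by (auto simp: indep_vars_def)
  have iX: "integrable M (X i)" if "i \<in> I" for i
    using square_integrable_imp_integrable[OF mX sq] that by simp
  have mY: "Y i \<in> borel_measurable M" and iY: "integrable M (Y i)" if "i \<in> I" for i
    using mX[OF that] iX[OF that] by (auto simp: Y_def[abs_def])
  have sqY: "integrable M (\<lambda>\<omega>. (Y i \<omega>)\<^sup>2)" if "i \<in> I" for i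
    using iX[OF that] sq[OF that] by (simp add: Y_def power2_diff)
  have EY: "expectation (Y i) = 0" if "i \<in> I" for i
    using iX[OF that] by (simp add: Y_def[abs_def] prob_space)
  have indY: "indep_vars (\<lambda>_. borel) Y I"
    unfolding Y_def[abs_def] using ind
    by (rule indep_vars_compose2[where Y = "\<lambda>i x. x - expectation (X i)"]) simp
  have YY: "expectation (\<lambda>\<omega>. Y i \<omega> * Y j \<omega>) = (if i = j then variance (X i) else 0)"
    if ij: "i \<in> I" "j \<in> I" for i j
  proof (cases "i = j")
    case True
    then show ?thesis by (simp add: Y_def power2_eq_square)
  next
    case False
    \<comment> \<open>As \<open>i\<close> and \<open>j\<close> differ, the product over
      \<open>{i, j}\<close> has exactly two factors, and each centred factor has expectation
      zero.\<close>
    have "expectation (\<lambda>\<omega>. \<Prod>k\<in>{i, j}. Y k \<omega>) = (\<Prod>k\<in>{i, j}. expectation (Y k))"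
      using ij iY by (intro indep_vars_lebesgue_integral indep_vars_subset[OF indY]) auto
    then show ?thesis using False EY[OF ij(1)] by simp
  qed
  have "variance (\<lambda>\<omega>. \<Sum>i\<in>I. X i \<omega>) = expectation (\<lambda>\<omega>. (\<Sum>i\<in>I. Y i \<omega>)\<^sup>2)"
    using iX by (simp add: Y_def sum_subtractf)
  also have "\<dots> = (\<Sum>i\<in>I. \<Sum>j\<in>I. expectation (\<lambda>\<omega>. Y i \<omega> * Y j \<omega>))"
    unfolding power2_eq_square sum_product
    using mY sqY
    by (simp add: Bochner_Integration.integral_sum Bochner_Integration.integrable_sum
        integrable_mult_of_squares)
  also have "\<dots> = (\<Sum>i\<in>I. variance (X i))"
    using fin by (simp add: YY sum.delta)
  finally show ?thesis .
qed

section \<open>Measurability of conjugation and of the phase factor\<close>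

lemma borel_measurable_cnj:
  "f \<in> borel_measurable M \<Longrightarrow> (\<lambda>x. cnj (f x)) \<in> borel_measurable M"
  by (rule borel_measurable_continuous_on[where f = cnj]) (auto intro: continuous_intros)

text \<open>The jump of \<open>Arg\<close> on the negative real axis disappears under
  \<open>cis\<close>: away from the origin the function is z/|z|, and at the origin it is 1 because
  \<open>Arg 0 = 0\<close>.\<close>

lemma measurable_cis_Arg: "(\<lambda>z. cis (Arg z)) \<in> borel_measurable borel"
proof -
  have "(\<lambda>z. cis (Arg z)) = (\<lambda>z. if z = 0 then 1 else z / of_real (norm z))"
    by (auto simp: fun_eq_iff cis_Arg sgn_eq Arg_zero)
  then show ?thesis by simp
qed

section \<open>The standard complex normal law and the entries of a vector with that law\<close>

lemma prob_space_complex_std_normal: "prob_space complex_std_normal"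
proof -
  interpret prob_space "density lborel (normal_density 0 (sqrt (1/2)))"
    by (rule prob_space_normal_density) simp
  interpret pair_prob_space "density lborel (normal_density 0 (sqrt (1/2)))"
    "density lborel (normal_density 0 (sqrt (1/2)))" ..
  show ?thesis
    unfolding complex_std_normal_def by (rule P.prob_space_distr) (simp add: case_prod_unfold Complex_eq)
qed

lemma sets_complex_std_normal [simp, measurable_cong]: "sets complex_std_normal = sets borel"
  by (simp add: complex_std_normal_def)

text \<open>The squared modulus is the sum of two squared coordinates, each with a finite Gaussian
  second moment. The value of the integral is left unevaluated; it enters the final bound as a
  constant.\<close>

lemma integrable_norm_square_complex_std_normal:
  "integrable complex_std_normal (\<lambda>z. (norm z)\<^sup>2)"
proof -
  define D where "D = density lborel (normal_density 0 (sqrt (1/2)))"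
  have "prob_space D"
    unfolding D_def by (rule prob_space_normal_density) simp
  then interpret prob_space D .
  interpret pair_prob_space D D ..
  have [measurable_cong]: "sets D = sets borel" by (simp add: D_def)
  have sq: "integrable D (\<lambda>x. x\<^sup>2)"
    unfolding D_def using integrable_normal_moment[of "sqrt (1/2)" 0 2]
    by (subst integrable_density) (auto simp: normal_density_nonneg)
  have fst: "integrable (D \<Otimes>\<^sub>M D) (\<lambda>z. (fst z)\<^sup>2)"
  proof -
    have "integrable (distr (D \<Otimes>\<^sub>M D) D fst) (\<lambda>x. x\<^sup>2)"
      by (subst prob_space.distr_pair_fst[OF \<open>prob_space D\<close>]) (rule sq)
    then show ?thesis by (subst (asm) integrable_distr_eq) auto
  qed
  moreover have "integrable (D \<Otimes>\<^sub>M D) (\<lambda>z. (snd z)\<^sup>2)"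
    using integrable_product_swap[OF fst] by (simp add: case_prod_unfold)
  ultimately have "integrable (D \<Otimes>\<^sub>M D) (\<lambda>z. (fst z)\<^sup>2 + (snd z)\<^sup>2)" by simp
  moreover have "(\<lambda>z. Complex (fst z) (snd z)) \<in> borel_measurable (D \<Otimes>\<^sub>M D)"
    by (simp add: Complex_eq)
  ultimately show ?thesis
    unfolding complex_std_normal_def D_def[symmetric]
    by (subst integrable_distr_eq) (auto simp: case_prod_unfold cmod_power2)
qed

lemma CN_distributed_component:
  assumes "CN_distributed P N h" "n \<in> {1..N}"
  shows "(\<lambda>\<omega>. h \<omega> n) \<in> borel_measurable P"
    and "distr P borel (\<lambda>\<omega>. h \<omega> n) = complex_std_normal"
proof -
  have m: "random_cvec N h \<in> measurable P (cvec_space N)"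
    and d: "distr P (cvec_space N) (random_cvec N h) = complex_std_normal_vec N"
    using assms(1) by (auto simp: CN_distributed_def)
  have eq: "(\<lambda>\<omega>. h \<omega> n) = (\<lambda>x. x n) \<circ> random_cvec N h"
    using assms(2) by auto
  have c: "(\<lambda>x. x n) \<in> measurable (cvec_space N) borel"
    using assms(2) by (rule measurable_component_singleton)
  show "(\<lambda>\<omega>. h \<omega> n) \<in> borel_measurable P"
    unfolding eq using m c by (rule measurable_comp)
  have "distr P borel (\<lambda>\<omega>. h \<omega> n) = distr (complex_std_normal_vec N) borel (\<lambda>x. x n)"
    unfolding eq d[symmetric] using c m by (subst distr_distr) auto
  \<comment> \<open>Only the sigma-algebra of the target matters for \<open>distr\<close>; the
    target becomes the factor measure so that \<open>distr_PiM_component\<close> applies.\<close>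
  also have "\<dots> = distr (complex_std_normal_vec N) complex_std_normal (\<lambda>x. x n)"
    by (rule distr_cong) auto
  also have "\<dots> = complex_std_normal"
    unfolding complex_std_normal_vec_def using assms(2)
    by (intro distr_PiM_component prob_space_complex_std_normal) auto
  finally show "distr P borel (\<lambda>\<omega>. h \<omega> n) = complex_std_normal" .
qed

text \<open>The joint law is the product of the marginal laws, which characterises independence over
  the nonempty index set \<open>{1..N}\<close>.\<close>

lemma CN_distributed_indep_components:
  assumes "prob_space P" "CN_distributed P N h" "N \<ge> 1"
  shows "prob_space.indep_vars P (\<lambda>_. borel) (\<lambda>n \<omega>. h \<omega> n) {1..N}"
proof -
  interpret prob_space P by fact
  have "distr P (cvec_space N) (random_cvec N h) = complex_std_normal_vec N"
    using assms(2) by (simp add: CN_distributed_def)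
  also have "\<dots> = (\<Pi>\<^sub>M n\<in>{1..N}. distr P borel (\<lambda>\<omega>. h \<omega> n))"
    unfolding complex_std_normal_vec_def
    using CN_distributed_component(2)[OF assms(2)] by (intro PiM_cong) simp_all
  finally have "distr P (cvec_space N) (random_cvec N h) =
      (\<Pi>\<^sub>M n\<in>{1..N}. distr P borel (\<lambda>\<omega>. h \<omega> n))" .
  moreover have "random_variable borel (\<lambda>\<omega>. h \<omega> n)" if "n \<in> {1..N}" for n
    using CN_distributed_component(1)[OF assms(2) that] .
  ultimately show ?thesis
    using assms(3) by (subst indep_vars_iff_distr_eq_PiM') auto
qed

lemma CN_distributed_moment:
  assumes "CN_distributed P N h" "n \<in> {1..N}"
  shows "integrable P (\<lambda>\<omega>. (norm (h \<omega> n))\<^sup>2)"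
    and "(\<integral>\<omega>. (norm (h \<omega> n))\<^sup>2 \<partial>P) = (\<integral>z. (norm z)\<^sup>2 \<partial>complex_std_normal)"
proof -
  note h = CN_distributed_component[OF assms]
  show "integrable P (\<lambda>\<omega>. (norm (h \<omega> n))\<^sup>2)"
    using integrable_norm_square_complex_std_normal unfolding h(2)[symmetric]
    by (subst (asm) integrable_distr_eq) (use h(1) in auto)
  show "(\<integral>\<omega>. (norm (h \<omega> n))\<^sup>2 \<partial>P) = (\<integral>z. (norm z)\<^sup>2 \<partial>complex_std_normal)"
    unfolding h(2)[symmetric] by (subst integral_distr) (use h(1) in auto)
qed

section \<open>Decomposition of the received term by reflecting element\<close>

definition reflected_term ::
  "nat \<Rightarrow> (nat \<Rightarrow> real) \<Rightarrow> (nat \<Rightarrow> complex) \<Rightarrow> (nat \<Rightarrow> nat \<Rightarrow> complex) \<Rightarrow> nat \<Rightarrow> nat \<Rightarrow> real" where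
  "reflected_term K w hp hr i n = Re (cnj (hp n) * cis (weighted_phase K w hp hr n) * hr i n)"

lemma ell_rv_eq_sum:
  "ell_rv K N c w \<beta> p hp hr i \<omega> =
     \<beta> i * sqrt (p i) / (c * real N) * (\<Sum>n=1..N. reflected_term K w (hp \<omega>) (\<lambda>k. hr k \<omega>) i n)"
proof -
  have "sesq_form N u (reflecting_matrix \<theta>) v = (\<Sum>n=1..N. cnj (u n) * cis (\<theta> n) * v n)"
    for u \<theta> v
  proof -
    have "(\<Sum>n=1..N. cnj (u m) * reflecting_matrix \<theta> m n * v n) = cnj (u m) * cis (\<theta> m) * v m"
      if "m \<in> {1..N}" for m
    proof -
      have "(\<Sum>n=1..N. cnj (u m) * reflecting_matrix \<theta> m n * v n) =
          (\<Sum>n=1..N. if m = n then cnj (u m) * cis (\<theta> m) * v m else 0)"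
        by (rule sum.cong) (auto simp: reflecting_matrix_def)
      then show ?thesis using that by (simp only: sum.delta' finite_atLeastAtMost if_True)
    qed
    then show ?thesis unfolding sesq_form_def by (rule sum.cong[OF refl])
  qed
  then show ?thesis
    by (simp only: ell_rv_def ell_def reflected_term_def Re_sum)
qed

text \<open>The phase factor is expressed through \<open>cis (Arg z)\<close> alone, so
  \<open>measurable_cis_Arg\<close> suffices and \<open>Arg\<close> itself never has to be shown
  measurable. The minus sign in the phase becomes a conjugation.\<close>

lemma cis_weighted_phase:
  "cis (weighted_phase K w hp hr n) =
     cnj (cis (Arg (cnj (hp n)))) * cis (Arg (\<Sum>k=1..K. of_real (w k) * cnj (hr k n)))"
  by (simp add: weighted_phase_def cis_cnj cis_mult)

lemma abs_reflected_term_le: "\<bar>reflected_term K w hp hr i n\<bar> \<le> norm (hp n) * norm (hr i n)"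
  unfolding reflected_term_def
  by (rule order_trans[OF abs_Re_le_cmod]) (simp add: norm_mult)

section \<open>Independence, moments and the variance bound at fixed dimension\<close>

context
  fixes P :: "'a measure" and N K :: nat and I :: "nat set" and w :: "nat \<Rightarrow> real"
    and hp :: "'a \<Rightarrow> nat \<Rightarrow> complex" and hr :: "nat \<Rightarrow> 'a \<Rightarrow> nat \<Rightarrow> complex"
  assumes model: "channel_model P N I hp hr" and N: "N \<ge> 1"
    and fin: "finite I" and K: "{1..K} \<subseteq> I"
begin

interpretation prob_space P
  using model by (simp add: channel_model_def)

lemma indep_entries:
  "indep_vars (\<lambda>_. borel) (\<lambda>(j, n) \<omega>. (case j of None \<Rightarrow> hp | Some i \<Rightarrow> hr i) \<omega> n)
     (insert None (Some ` I) \<times> {1..N})"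
proof -
  have "indep_vars (\<lambda>(j, n). borel) (\<lambda>(j, n) \<omega>. (case j of None \<Rightarrow> hp | Some i \<Rightarrow> hr i) \<omega> n)
     (insert None (Some ` I) \<times> {1..N})"
    using model N fin
    by (intro indep_vars_Times CN_distributed_indep_components prob_space_axioms)
      (auto simp: channel_model_def)
  then show ?thesis by (simp add: case_prod_unfold)
qed

text \<open>The blocks of entries at different positions \<open>n\<close> are disjoint, and
  measurable functions of disjoint blocks of an independent family are independent. The block at
  \<open>n\<close> also holds the target entries that determine the phase.\<close>

lemma indep_reflected_terms:
  assumes i: "i \<in> I"
  shows "indep_vars (\<lambda>_. borel)
    (\<lambda>n \<omega>. reflected_term K w (hp \<omega>) (\<lambda>k. hr k \<omega>) i n) {1..N}"
proof -
  let ?J = "insert None (Some ` I)"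
  let ?H = "\<lambda>\<omega> (j, n). (case j of None \<Rightarrow> hp | Some i \<Rightarrow> hr i) \<omega> n"
  \<comment> \<open>The \<open>n\<close>-th term as a function of the block at \<open>n\<close>;
    \<open>f\<close> is evaluated only at pairs with second component \<open>n\<close>.\<close>
  let ?G = "\<lambda>n f. reflected_term K w (\<lambda>n. f (None, n)) (\<lambda>k n. f (Some k, n)) i n"
  have "indep_vars (\<lambda>n. PiM (?J \<times> {n}) (\<lambda>_. borel))
      (\<lambda>n \<omega>. restrict (\<lambda>s. (case s of (j, n) \<Rightarrow> \<lambda>\<omega>. (case j of None \<Rightarrow> hp | Some i \<Rightarrow> hr i) \<omega> n) \<omega>)
        (?J \<times> {n})) {1..N}"
    by (rule indep_vars_restrict[OF indep_entries]) (auto simp: disjoint_family_on_def)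
  moreover have "?G n \<in> borel_measurable (PiM (?J \<times> {n}) (\<lambda>_. borel))" for n
  proof -
    have comp: "(\<lambda>f. f (j, n)) \<in> borel_measurable (PiM (?J \<times> {n}) (\<lambda>_. borel :: complex measure))"
      if "j \<in> ?J" for j
      using that by (intro measurable_component_singleton) auto
    \<comment> \<open>Since \<open>{1..K} \<subseteq> I\<close>, every coordinate in this sum
      belongs to the block.\<close>
    have "(\<lambda>f. \<Sum>k=1..K. complex_of_real (w k) * cnj (f (Some k, n)))
        \<in> borel_measurable (PiM (?J \<times> {n}) (\<lambda>_. borel))"
      using K by (intro borel_measurable_sum borel_measurable_times borel_measurable_const
        borel_measurable_cnj comp) auto
    note Arg_sum = measurable_compose[OF this measurable_cis_Arg]
    show ?thesis
      unfolding reflected_term_def cis_weighted_phase using i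
      by (intro measurable_compose[OF _ borel_measurable_Re] borel_measurable_times borel_measurable_cnj comp Arg_sum
        measurable_compose[OF _ measurable_cis_Arg]) auto
  qed
  ultimately have "indep_vars (\<lambda>_. borel) (\<lambda>n \<omega>. ?G n (restrict (\<lambda>s. (case s of (j, n) \<Rightarrow>
      \<lambda>\<omega>. (case j of None \<Rightarrow> hp | Some i \<Rightarrow> hr i) \<omega> n) \<omega>) (?J \<times> {n}))) {1..N}"
    by (rule indep_vars_compose2)
  moreover have "?G n (restrict (\<lambda>s. (case s of (j, n) \<Rightarrow>
      \<lambda>\<omega>. (case j of None \<Rightarrow> hp | Some i \<Rightarrow> hr i) \<omega> n) \<omega>) (?J \<times> {n})) =
      reflected_term K w (hp \<omega>) (\<lambda>k. hr k \<omega>) i n" for n \<omega>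
  proof -
    have "(\<Sum>k=1..K. of_real (w k) * cnj (restrict (\<lambda>s. (case s of (j, n) \<Rightarrow>
        \<lambda>\<omega>. (case j of None \<Rightarrow> hp | Some i \<Rightarrow> hr i) \<omega> n) \<omega>) (?J \<times> {n}) (Some k, n))) =
      (\<Sum>k=1..K. of_real (w k) * cnj (hr k \<omega> n))"
      using K by (intro sum.cong) auto
    then show ?thesis
      using i by (simp add: reflected_term_def cis_weighted_phase)
  qed
  ultimately show ?thesis by simp
qed

text \<open>The phase depends on the channels, but the pointwise majorant |h_p,n| |h_r,i,n| does not
  involve it. The second moment of that majorant factors by independence of the two entries, equally
  for targets and interferers.\<close>

lemma reflected_term_second_moment:
  assumes i: "i \<in> I" and n: "n \<in> {1..N}"
  defines "X \<equiv> \<lambda>\<omega>. reflected_term K w (hp \<omega>) (\<lambda>k. hr k \<omega>) i n"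
  shows "integrable P (\<lambda>\<omega>. (X \<omega>)\<^sup>2)"
    and "expectation (\<lambda>\<omega>. (X \<omega>)\<^sup>2) \<le> (\<integral>z. (norm z)\<^sup>2 \<partial>complex_std_normal)\<^sup>2"
proof -
  let ?v = "\<integral>z. (norm z)\<^sup>2 \<partial>complex_std_normal"
  let ?h = "\<lambda>(j, n) \<omega>. (case j of None \<Rightarrow> hp | Some i \<Rightarrow> hr i) \<omega> n"
  let ?S = "{(None, n), (Some i, n)}"
  have CN: "CN_distributed P N hp" "CN_distributed P N (hr i)"
    using model i by (auto simp: channel_model_def)
  have [measurable]: "X \<in> borel_measurable P"
    using indep_reflected_terms[OF i] n by (auto simp: indep_vars_def X_def)
  have ind: "indep_vars (\<lambda>_. borel) (\<lambda>s \<omega>. (norm (?h s \<omega>))\<^sup>2) ?S"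
    by (rule indep_vars_compose2[OF indep_vars_subset[OF indep_entries], where Y = "\<lambda>_ z. (norm z)\<^sup>2"])
      (use i n in auto)
  have int: "integrable P (\<lambda>\<omega>. (norm (?h s \<omega>))\<^sup>2)" if "s \<in> ?S" for s
    using that CN_distributed_moment(1)[OF CN(1) n] CN_distributed_moment(1)[OF CN(2) n] by auto
  have bound_int: "integrable P (\<lambda>\<omega>. (norm (hp \<omega> n))\<^sup>2 * (norm (hr i \<omega> n))\<^sup>2)"
    using indep_vars_integrable[OF _ ind int] by simp
  have bound_val: "expectation (\<lambda>\<omega>. (norm (hp \<omega> n))\<^sup>2 * (norm (hr i \<omega> n))\<^sup>2) = ?v\<^sup>2"
    using indep_vars_lebesgue_integral[OF _ ind int]
      CN_distributed_moment(2)[OF CN(1) n] CN_distributed_moment(2)[OF CN(2) n]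
    by (simp add: power2_eq_square)
  have le: "(X \<omega>)\<^sup>2 \<le> (norm (hp \<omega> n))\<^sup>2 * (norm (hr i \<omega> n))\<^sup>2" for \<omega>
    using power_mono[OF abs_reflected_term_le[of K w "hp \<omega>" "\<lambda>k. hr k \<omega>" i n] abs_ge_zero, of 2]
    by (simp add: X_def power_mult_distrib)
  show int: "integrable P (\<lambda>\<omega>. (X \<omega>)\<^sup>2)"
    by (rule Bochner_Integration.integrable_bound[OF bound_int]) (auto simp: le)
  show "expectation (\<lambda>\<omega>. (X \<omega>)\<^sup>2) \<le> ?v\<^sup>2"
    unfolding bound_val[symmetric] by (rule integral_mono[OF int bound_int le])
qed

lemma finite_variance_ell_rv:
  assumes i: "i \<in> I"
  shows "finite_variance P (ell_rv K N c w \<beta> p hp hr i)"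
proof -
  let ?S = "\<lambda>\<omega>. \<Sum>n=1..N. reflected_term K w (hp \<omega>) (\<lambda>k. hr k \<omega>) i n"
  have m: "(\<lambda>\<omega>. reflected_term K w (hp \<omega>) (\<lambda>k. hr k \<omega>) i n) \<in> borel_measurable P"
    if "n \<in> {1..N}" for n
    using indep_reflected_terms[OF i] that by (auto simp: indep_vars_def)
  let ?a = "\<beta> i * sqrt (p i) / (c * real N)"
  have sq: "integrable P (\<lambda>\<omega>. (?S \<omega>)\<^sup>2)"
    using m reflected_term_second_moment(1)[OF i] by (rule integrable_sum_square)
  have "?S \<in> borel_measurable P"
    using m by (rule borel_measurable_sum)
  then have "integrable P ?S"
    using sq by (rule square_integrable_imp_integrable)
  then have "integrable P (\<lambda>\<omega>. ?a * ?S \<omega>)"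
    by (rule integrable_mult_right)
  moreover have "integrable P (\<lambda>\<omega>. ?a\<^sup>2 * (?S \<omega>)\<^sup>2)"
    using sq by (rule integrable_mult_right)
  moreover have "ell_rv K N c w \<beta> p hp hr i = (\<lambda>\<omega>. ?a * ?S \<omega>)"
    by (rule ext) (rule ell_rv_eq_sum)
  ultimately show ?thesis
    by (simp only: finite_variance_def power_mult_distrib)
qed

text \<open>The sum contributes at most \<open>N\<close> times a constant and the squared prefactor
  is a constant over N^2, which leaves a constant over N.\<close>

lemma variance_ell_rv_le:
  assumes i: "i \<in> I"
  shows "variance (ell_rv K N c w \<beta> p hp hr i) \<le>
    (\<beta> i * sqrt (p i) / c * (\<integral>z. (norm z)\<^sup>2 \<partial>complex_std_normal))\<^sup>2 * (1 / real N)"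
proof -
  let ?v = "\<integral>z. (norm z)\<^sup>2 \<partial>complex_std_normal"
  let ?X = "\<lambda>n \<omega>. reflected_term K w (hp \<omega>) (\<lambda>k. hr k \<omega>) i n"
  let ?a = "\<beta> i * sqrt (p i) / (c * real N)"
  have "variance (ell_rv K N c w \<beta> p hp hr i) = ?a\<^sup>2 * variance (\<lambda>\<omega>. \<Sum>n=1..N. ?X n \<omega>)"
    unfolding ell_rv_eq_sum[abs_def]
    by (simp only: integral_mult_right_zero power_mult_distrib right_diff_distrib[symmetric])
  also have "variance (\<lambda>\<omega>. \<Sum>n=1..N. ?X n \<omega>) = (\<Sum>n=1..N. variance (?X n))"
    by (rule variance_sum_indep[OF _ indep_reflected_terms[OF i] reflected_term_second_moment(1)[OF i]]) simp
  also have "?a\<^sup>2 * \<dots> \<le> ?a\<^sup>2 * (\<Sum>n=1..N. ?v\<^sup>2)"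
  proof (intro mult_left_mono sum_mono)
    fix n assume n: "n \<in> {1..N}"
    note sq = reflected_term_second_moment[OF i n]
    have "?X n \<in> borel_measurable P"
      using indep_reflected_terms[OF i] n by (auto simp: indep_vars_def)
    then have "integrable P (?X n)"
      using sq(1) by (rule square_integrable_imp_integrable)
    \<comment> \<open>The mean of a term need not be computed: discarding its square only enlarges
      the bound.\<close>
    then have "variance (?X n) = expectation (\<lambda>\<omega>. (?X n \<omega>)\<^sup>2) - (expectation (?X n))\<^sup>2"
      using sq(1) by (rule variance_eq)
    also have "\<dots> \<le> ?v\<^sup>2"
      using sq(2) zero_le_power2[of "expectation (?X n)"] by linarith
    finally show "variance (?X n) \<le> ?v\<^sup>2" .
  qed simp
  also have "?a\<^sup>2 * (\<Sum>n=1..N. ?v\<^sup>2) = (\<beta> i * sqrt (p i) / c * ?v)\<^sup>2 * (1 / real N)"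
    \<comment> \<open>For \<open>c = 0\<close> both sides vanish because division by zero yields
      zero; otherwise one factor \<open>N\<close> cancels.\<close>
    using N by (cases "c = 0") (simp_all add: power2_eq_square field_simps)
  finally show ?thesis .
qed

end

theorem theorem2:
  fixes K M :: nat and c :: real and w \<beta> p :: "nat \<Rightarrow> real"
    and P :: "nat \<Rightarrow> 'a measure"
    and hp :: "nat \<Rightarrow> 'a \<Rightarrow> nat \<Rightarrow> complex"
    and hr :: "nat \<Rightarrow> nat \<Rightarrow> 'a \<Rightarrow> nat \<Rightarrow> complex"
  assumes "K \<ge> 1" and "M \<ge> 1" and "c > 0"
    and "\<And>k. k \<in> {1..K} \<Longrightarrow> w k > 0"
    and "\<And>i. i \<in> {1..K} \<union> {K+1..K+M} \<Longrightarrow> \<beta> i > 0"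
    and "\<And>i. i \<in> {1..K} \<union> {K+1..K+M} \<Longrightarrow> p i > 0"
    and "\<And>N. N \<ge> 1 \<Longrightarrow> channel_model (P N) N ({1..K} \<union> {K+1..K+M}) (hp N) (hr N)"
  shows "\<forall>k\<in>{1..K}. \<forall>m\<in>{K+1..K+M}.
    (\<forall>N\<ge>1. finite_variance (P N) (ell_rv K N c w \<beta> p (hp N) (hr N) k)) \<and>
    (\<forall>N\<ge>1. finite_variance (P N) (ell_rv K N c w \<beta> p (hp N) (hr N) m)) \<and>
    (\<lambda>N. prob_space.variance (P N) (ell_rv K N c w \<beta> p (hp N) (hr N) k)) \<in> O(\<lambda>N. 1 / real N) \<and>
    (\<lambda>N. prob_space.variance (P N) (ell_rv K N c w \<beta> p (hp N) (hr N) m)) \<in> O(\<lambda>N. 1 / real N)"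
proof -
  let ?I = "{1..K} \<union> {K+1..K+M}"
  have sub: "{1..K} \<subseteq> ?I" by blast
  note model = assms(7)
  have fv: "finite_variance (P N) (ell_rv K N c w \<beta> p (hp N) (hr N) i)"
    if "i \<in> ?I" "N \<ge> 1" for i N
    using finite_variance_ell_rv[OF model[OF that(2)] that(2) _ sub that(1)] by simp
  have bigo: "(\<lambda>N. prob_space.variance (P N) (ell_rv K N c w \<beta> p (hp N) (hr N) i)) \<in> O(\<lambda>N. 1 / real N)"
    if i: "i \<in> ?I" for i
  proof (rule bigoI)
    \<comment> \<open>The constant is free of \<open>N\<close>, although the probability space
      changes with \<open>N\<close>.\<close>
    let ?C = "(\<beta> i * sqrt (p i) / c * (\<integral>z. (norm z)\<^sup>2 \<partial>complex_std_normal))\<^sup>2"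
    show "\<forall>\<^sub>F N in at_top. norm (prob_space.variance (P N) (ell_rv K N c w \<beta> p (hp N) (hr N) i))
        \<le> ?C * norm (1 / real N)"
      \<comment> \<open>The channel model is available only from dimension 1 on, so
        \<open>N = 0\<close> is excluded here.\<close>
      using eventually_ge_at_top[of 1]
    proof eventually_elim
      case (elim N)
      then show ?case
        using variance_ell_rv_le[OF model[OF elim] elim _ sub i, where w = w and c = c and \<beta> = \<beta> and p = p]
        by (simp add: integral_nonneg_AE)
    qed
  qed
  show ?thesis
    using fv bigo by auto
qed

end
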